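(* Let $[S]=\{[f]_1,\ldots,[f]_\ell\}\subset[\mathbb{R}][x_1,\ldots,x_n]$ be a finite system of interval polynomials and let $\prec$ be a monomial ordering on $\mathbb{R}[x_1,\ldots,x_n]$. Then the set of initial ideals $$\{\,in(I)\ :\ I\in\mathcal{IF}([S])\,\}$$ is finite.
   Context: A real interval is a set of one of the forms $[a,b]$, $(a,b]$, $[a,b)$, $(a,b)$ with $a,b\in\mathbb{R}\cup\{\pm\infty\}$ (closed endpoints finite). An interval polynomial is a formal expression $[f]=\sum_{i=1}^m I_i\,x^{\alpha_i}$ where each $I_i$ is a real interval and the $x^{\alpha_i}$ are monomials in $x_1,\dots,x_n$; $[\mathbb{R}][x_1,\ldots,x_n]$ denotes the set of interval polynomials. The family of $[f]$ is $\mathcal{F}([f])=\{\sum_{i=1}^m c_i x^{\alpha_i}: c_i\in I_i\}\subset\mathbb{R}[x_1,\dots,x_n]$, and for $[S]=\{[f]_1,\ldots,[f]_\ell\}$, $\mathcal{F}([S])=\mathcal{F}([f]_1)\times\cdots\times\mathcal{F}([f]_\ell)$. The ideal family is $\mathcal{IF}([S])=\{\langle p_1,\ldots,p_\ell\rangle : (p_1,\ldots,p_\ell)\in\mathcal{F}([S])\}$. For an ideal $I\subseteq\mathbb{R}[x_1,\dots,x_n]$, $in(I)$ is the ideal generated by the leading monomials (w.r.t. $\prec$) of the nonzero elements of $I$. *)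

theory Defs
  imports Complex_Main "HOL-Library.Poly_Mapping"
begin

text \<open>Polynomials in the variables indexed by a finite type 'v (the variables x_1,...,x_n)
  with real coefficients: exponent vectors, polynomials as finitely supported maps
  from exponent vectors to reals; ring operations from Poly_Mapping.\<close>

type_synonym 'v monom = "'v \<Rightarrow>\<^sub>0 nat"
type_synonym 'v rpoly = "'v monom \<Rightarrow>\<^sub>0 real"

definition real_interval :: "real set \<Rightarrow> bool" where
  "real_interval S \<longleftrightarrow>
     (\<exists>a b. S = {a..b} \<or> S = {a<..b} \<or> S = {a..<b} \<or> S = {a<..<b}) \<or>
     (\<exists>a. S = {a..} \<or> S = {a<..} \<or> S = {..a} \<or> S = {..<a}) \<or> S = UNIV"

definition monomial_order :: "('v monom \<Rightarrow> 'v monom \<Rightarrow> bool) \<Rightarrow> bool" where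
  "monomial_order le \<longleftrightarrow>
     (\<forall>a. le a a) \<and>
     (\<forall>a b. le a b \<and> le b a \<longrightarrow> a = b) \<and>
     (\<forall>a b c. le a b \<and> le b c \<longrightarrow> le a c) \<and>
     (\<forall>a b. le a b \<or> le b a) \<and>
     (\<forall>a b c. le a b \<longrightarrow> le (a + c) (b + c)) \<and>
     wf {(a, b). le a b \<and> a \<noteq> b}"

definition ideal_gen :: "'v rpoly set \<Rightarrow> 'v rpoly set" where
  "ideal_gen G = {p. \<exists>F c. finite F \<and> F \<subseteq> G \<and> p = (\<Sum>g\<in>F. c g * g)}"

definition lead_monom :: "('v monom \<Rightarrow> 'v monom \<Rightarrow> bool) \<Rightarrow> 'v rpoly \<Rightarrow> 'v monom" where
  "lead_monom le p = (THE a. a \<in> Poly_Mapping.keys p \<and> (\<forall>b\<in>Poly_Mapping.keys p. le b a))"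

definition init_ideal :: "('v monom \<Rightarrow> 'v monom \<Rightarrow> bool) \<Rightarrow> 'v rpoly set \<Rightarrow> 'v rpoly set" where
  "init_ideal le I = ideal_gen {Poly_Mapping.single (lead_monom le p) 1 | p. p \<in> I \<and> p \<noteq> 0}"

text \<open>An interval polynomial sum_i I_i x^alpha_i, as the list of pairs (I_i, alpha_i).\<close>
type_synonym 'v interval_poly = "(real set \<times> 'v monom) list"

definition family :: "'v interval_poly \<Rightarrow> 'v rpoly set" where
  "family F = {p. \<exists>cs. length cs = length F \<and> (\<forall>i<length F. cs ! i \<in> fst (F ! i)) \<and>
                       p = (\<Sum>i<length F. Poly_Mapping.single (snd (F ! i)) (cs ! i))}"

definition ideal_family :: "'v interval_poly list \<Rightarrow> 'v rpoly set set" where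
  "ideal_family S = {ideal_gen (set ps) | ps. length ps = length S \<and>
                       (\<forall>i<length S. ps ! i \<in> family (S ! i))}"

end

theory Submission
  imports Defs
begin

text \<open>The coefficient intervals only matter through the finite set \<open>A\<close> of exponents that may
  occur. For a set \<open>G\<close> of polynomials supported in \<open>A\<close>, enlarge \<open>A\<close> to a finite set \<open>A'\<close>,
  depending on \<open>A\<close> alone, that contains the supports of all S-polynomials of elements of \<open>G\<close> and
  of everything met while reducing them by \<open>G\<close>, and let \<open>G'\<close> be the set of elements of the ideal
  of \<open>G\<close> supported in \<open>A'\<close>. If the leading monomials of \<open>G'\<close> are all divisible by leading
  monomials of \<open>G\<close>, Buchberger's criterion shows that the initial ideal is generated by the
  latter. Otherwise \<open>G'\<close> generates the same ideal but has a strictly larger set of multiples of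
  leading monomials, which is one of finitely many sets. By Dickson's lemma, this process is
  well-founded, so finite branching yields finitely many initial ideals.\<close>

abbreviation keys :: "('a \<Rightarrow>\<^sub>0 'b::zero) \<Rightarrow> 'a set" where
  "keys \<equiv> Poly_Mapping.keys"

abbreviation lookup :: "('a \<Rightarrow>\<^sub>0 'b::zero) \<Rightarrow> 'a \<Rightarrow> 'b" where
  "lookup \<equiv> Poly_Mapping.lookup"

section \<open>Dickson's lemma\<close>

text \<open>Any sequence has a monotone subsequence. A decreasing one in the naturals attains a
  least value and is constant from there on, so its tail is also increasing.\<close>

lemma nat_seq_mono_subseq:
  fixes s :: "nat \<Rightarrow> nat"
  shows "\<exists>f :: nat \<Rightarrow> nat. strict_mono f \<and> mono (\<lambda>n. s (f n))"
proof -
  obtain f where f: "strict_mono f" and m: "monoseq (\<lambda>n. s (f n))"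
    using seq_monosub[of s] by blast
  show ?thesis
  proof (cases "mono (\<lambda>n. s (f n))")
    case True
    then show ?thesis using f by blast
  next
    case False
    then have dec: "decseq (\<lambda>n. s (f n))"
      using m unfolding monoseq_iff by blast
    obtain n0 where n0: "\<And>n. s (f n0) \<le> s (f n)"
      using ex_has_least_nat[of "\<lambda>_. True" 0 "\<lambda>n. s (f n)"] by auto
    have const: "s (f (n0 + n)) = s (f n0)" for n
      using n0[of "n0 + n"] decseqD[OF dec, of n0 "n0 + n"] by simp
    have "strict_mono (\<lambda>n. f (n0 + n))"
      using f by (simp add: strict_mono_def)
    moreover have "mono (\<lambda>n. s (f (n0 + n)))"
      by (simp add: const mono_def)
    ultimately show ?thesis by blast
  qed
qed

text \<open>Coordinates are handled one at a time: passing to a further subsequence keeps the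
  monotonicity already reached.\<close>

lemma nat_fun_seq_mono_subseq:
  fixes s :: "nat \<Rightarrow> 'v \<Rightarrow> nat"
  assumes "finite V"
  shows "\<exists>f :: nat \<Rightarrow> nat. strict_mono f \<and> (\<forall>v\<in>V. mono (\<lambda>n. s (f n) v))"
  using assms
proof (induction V rule: finite_induct)
  case empty
  show ?case by (rule exI[of _ "\<lambda>n. n"]) (simp add: strict_mono_def)
next
  case (insert v V)
  then obtain f :: "nat \<Rightarrow> nat" where f: "strict_mono f" "\<And>w. w \<in> V \<Longrightarrow> mono (\<lambda>n. s (f n) w)" by blast
  obtain h :: "nat \<Rightarrow> nat" where h: "strict_mono h" "mono (\<lambda>n. s (f (h n)) v)"
    using nat_seq_mono_subseq[of "\<lambda>n. s (f n) v"] by blast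
  have "mono (\<lambda>n. s (f (h n)) w)" if "w \<in> V" for w
    using f(2)[OF that] strict_mono_mono[OF h(1)] by (simp add: mono_def)
  moreover have "strict_mono (\<lambda>n. f (h n))"
    using f(1) h(1) by (simp add: strict_mono_def)
  ultimately show ?case using h(2) by blast
qed

lemma monom_diff_add:
  fixes a b :: "'v monom"
  assumes "\<And>v. lookup a v \<le> lookup b v"
  shows "(b - a) + a = b"
  using assms by (intro poly_mapping_eqI) (simp add: lookup_add minus_poly_mapping.rep_eq)

text \<open>Along a subsequence that is monotone in every coordinate, each monomial divides all
  later ones; the first two members suffice.\<close>

lemma dickson:
  fixes s :: "nat \<Rightarrow> ('v::finite) monom"
  shows "\<exists>i j u. i < j \<and> s j = u + s i"
proof -
  obtain f :: "nat \<Rightarrow> nat" where f: "strict_mono f" "\<And>v. mono (\<lambda>n. lookup (s (f n)) v)"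
    using nat_fun_seq_mono_subseq[of "UNIV :: 'v set" "\<lambda>n. lookup (s n)"] by auto
  have "lookup (s (f 0)) v \<le> lookup (s (f 1)) v" for v
    using f(2)[of v] by (simp add: mono_def)
  then have "s (f 1) = (s (f 1) - s (f 0)) + s (f 0)"
    by (simp add: monom_diff_add)
  moreover have "f 0 < f 1" using f(1) by (simp add: strict_mono_def)
  ultimately show ?thesis by blast
qed

section \<open>Monomial ideals as sets of exponents, and their ascending chain condition\<close>

definition multiples :: "'v monom set \<Rightarrow> 'v monom set" where
  "multiples M = {u + m | u m. m \<in> M}"

lemma multiplesI: "m \<in> M \<Longrightarrow> u + m \<in> multiples M"
  by (auto simp: multiples_def)

lemma subset_multiples: "M \<subseteq> multiples M"
  using multiplesI[of _ M 0] by auto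

lemma multiples_mono: "M \<subseteq> N \<Longrightarrow> multiples M \<subseteq> multiples N"
  by (auto simp: multiples_def)

lemma multiples_multiples [simp]: "multiples (multiples M) = multiples M"
proof
  show "multiples (multiples M) \<subseteq> multiples M"
    by (auto simp: multiples_def) (metis add.assoc)
qed (rule subset_multiples)

text \<open>The larger monomial ideal counts as the smaller element, so induction may assume the
  claim for sets with strictly more multiples. In an infinite ascending chain, choose at each stage
  an exponent that is new at the next one; by Dickson's lemma some chosen exponent is a multiple of
  an earlier one and hence not new.\<close>

lemma wf_multiples: "wf {(M, N :: ('v::finite) monom set). multiples N \<subset> multiples M}"
proof (unfold wf_iff_no_infinite_down_chain, rule notI)
  assume "\<exists>F. \<forall>i. (F (Suc i), F i) \<in> {(M, N :: 'v monom set). multiples N \<subset> multiples M}"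
  then obtain F :: "nat \<Rightarrow> 'v monom set"
    where F: "\<And>i. multiples (F i) \<subset> multiples (F (Suc i))" by auto
  then have "\<forall>i. \<exists>t. t \<in> multiples (F (Suc i)) \<and> t \<notin> multiples (F i)" by blast
  then obtain s where s: "\<And>i. s i \<in> multiples (F (Suc i))" "\<And>i. s i \<notin> multiples (F i)"
    by metis
  obtain i j u where ij: "i < j" "s j = u + s i" using dickson[of s] by blast
  have "multiples (F (Suc i)) \<subseteq> multiples (F j)"
    by (rule lift_Suc_mono_le[of "\<lambda>i. multiples (F i)"]) (use F ij(1) in auto)
  then have "s j \<in> multiples (multiples (F j))"
    using s(1)[of i] ij(2) multiplesI by (metis subsetD)
  then show False using s(2)[of j] by simp
qed

section \<open>Monomials and ideals\<close>

lemma lookup_single_mult: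
  fixes g :: "'v rpoly"
  shows "lookup (Poly_Mapping.single u c * g) (u + a) = c * lookup g a"
  by (simp add: lookup_mult lookup_single when_mult)

lemma keys_single_mult:
  fixes g :: "'v rpoly"
  shows "keys (Poly_Mapping.single u c * g) \<subseteq> (+) u ` keys g"
  using keys_mult[of "Poly_Mapping.single u c" g] by (auto split: if_splits)

lemma keys_diff_subset:
  fixes p q :: "'a \<Rightarrow>\<^sub>0 'b::ab_group_add"
  shows "keys (p - q) \<subseteq> keys p \<union> keys q"
  by (auto simp: in_keys_iff lookup_minus)

lemma ideal_gen_zero: "0 \<in> ideal_gen G"
  unfolding ideal_gen_def by (auto intro!: exI[of _ "{}"])

lemma ideal_gen_add:
  assumes "p \<in> ideal_gen G" "q \<in> ideal_gen G"
  shows "p + q \<in> ideal_gen G"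
proof -
  obtain E c F d where E: "finite E" "E \<subseteq> G" "p = (\<Sum>g\<in>E. c g * g)"
    and F: "finite F" "F \<subseteq> G" "q = (\<Sum>g\<in>F. d g * g)"
    using assms unfolding ideal_gen_def by blast
  \<comment> \<open>Both coefficient families are extended by zero to the common index set
    \<open>E \<union> F\<close>.\<close>
  define e where "e g = (if g \<in> E then c g else 0) + (if g \<in> F then d g else 0)" for g
  have "p = (\<Sum>g\<in>E \<union> F. (if g \<in> E then c g else 0) * g)"
    unfolding E(3) using E(1) F(1) by (intro sum.mono_neutral_cong_left) auto
  moreover have "q = (\<Sum>g\<in>E \<union> F. (if g \<in> F then d g else 0) * g)"
    unfolding F(3) using E(1) F(1) by (intro sum.mono_neutral_cong_left) auto
  ultimately have "p + q = (\<Sum>g\<in>E \<union> F. e g * g)"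
    by (simp add: e_def distrib_right sum.distrib)
  then show ?thesis using E(1,2) F(1,2) unfolding ideal_gen_def by blast
qed

lemma ideal_gen_mult:
  assumes "p \<in> ideal_gen G"
  shows "r * p \<in> ideal_gen G"
proof -
  obtain E c where "finite E" "E \<subseteq> G" "p = (\<Sum>g\<in>E. c g * g)"
    using assms unfolding ideal_gen_def by blast
  then have "r * p = (\<Sum>g\<in>E. (r * c g) * g)"
    by (simp add: sum_distrib_left mult.assoc)
  then show ?thesis
    using \<open>finite E\<close> \<open>E \<subseteq> G\<close> unfolding ideal_gen_def
    by (auto intro!: exI[of _ E] exI[of _ "\<lambda>g. r * c g"])
qed

lemma ideal_gen_superset: "G \<subseteq> ideal_gen G"
proof
  fix g assume "g \<in> G"
  then show "g \<in> ideal_gen G"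
    unfolding ideal_gen_def by (auto intro!: exI[of _ "{g}"] exI[of _ "\<lambda>_. 1"])
qed

lemma ideal_gen_diff: "p \<in> ideal_gen G \<Longrightarrow> q \<in> ideal_gen G \<Longrightarrow> p - q \<in> ideal_gen G"
  using ideal_gen_add[of p G "(-1) * q"] ideal_gen_mult[of q G "-1"] by simp

lemma ideal_gen_subset:
  assumes "H \<subseteq> ideal_gen G"
  shows "ideal_gen H \<subseteq> ideal_gen G"
proof
  fix p assume "p \<in> ideal_gen H"
  then obtain E c where E: "finite E" "E \<subseteq> H" and p: "p = (\<Sum>g\<in>E. c g * g)"
    unfolding ideal_gen_def by blast
  from E have "(\<Sum>g\<in>E. c g * g) \<in> ideal_gen G"
  proof (induction E rule: finite_induct)
    case (insert x F)
    then show ?case using assms by (auto intro!: ideal_gen_add ideal_gen_mult)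
  qed (simp add: ideal_gen_zero)
  then show "p \<in> ideal_gen G" using p by simp
qed

section \<open>Buchberger's criterion\<close>

locale mon_order =
  fixes le :: "('v::finite) monom \<Rightarrow> 'v monom \<Rightarrow> bool"
  assumes monomial_order: "monomial_order le"
begin

abbreviation lt :: "'v monom \<Rightarrow> 'v monom \<Rightarrow> bool" where
  "lt a b \<equiv> le a b \<and> a \<noteq> b"

lemma
  shows le_refl: "le a a"
    and le_antisym: "le a b \<Longrightarrow> le b a \<Longrightarrow> a = b"
    and le_trans: "le a b \<Longrightarrow> le b c \<Longrightarrow> le a c"
    and le_total: "le a b \<or> le b a"
    and le_add_left: "le a b \<Longrightarrow> le (c + a) (c + b)"
    and wf_lt: "wf {(a, b). lt a b}"
  using monomial_order unfolding monomial_order_def by (metis add.commute)+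

lemma lt_add_left: "lt a b \<Longrightarrow> lt (c + a) (c + b)"
  using le_add_left by auto

lemma lt_trans: "lt a b \<Longrightarrow> lt b c \<Longrightarrow> lt a c"
  using le_trans le_antisym by blast

section \<open>Leading monomials and leading coefficients\<close>

abbreviation lm :: "'v rpoly \<Rightarrow> 'v monom" where
  "lm \<equiv> lead_monom le"

abbreviation lc :: "'v rpoly \<Rightarrow> real" where
  "lc p \<equiv> lookup p (lm p)"

lemma finite_has_greatest:
  assumes "finite X" "X \<noteq> {}"
  shows "\<exists>a\<in>X. \<forall>b\<in>X. le b a"
  using assms
proof (induction X rule: finite_ne_induct)
  case (insert x X)
  then show ?case by (metis insert_iff le_refl le_total le_trans)
qed (simp add: le_refl)

lemma lead_monom_eqI:
  assumes "a \<in> keys p" "\<And>b. b \<in> keys p \<Longrightarrow> le b a"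
  shows "lm p = a"
  unfolding lead_monom_def using assms le_antisym by (intro the_equality) auto

lemma
  assumes "p \<noteq> 0"
  shows lm_in_keys: "lm p \<in> keys p"
    and le_lm: "b \<in> keys p \<Longrightarrow> le b (lm p)"
proof -
  have "keys p \<noteq> {}"
    using assms by (metis equals0I in_keys_iff lookup_zero poly_mapping_eqI)
  then obtain a where a: "a \<in> keys p" "\<forall>b\<in>keys p. le b a"
    using finite_has_greatest[of "keys p"] by auto
  then have "lm p = a" by (simp add: lead_monom_eqI)
  then show "lm p \<in> keys p" "b \<in> keys p \<Longrightarrow> le b (lm p)" using a by auto
qed

lemma lc_nonzero: "p \<noteq> 0 \<Longrightarrow> lc p \<noteq> 0"
  using lm_in_keys by (simp add: in_keys_iff)

lemma lm_single_mult:
  assumes "g \<noteq> 0" "c \<noteq> 0"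
  shows "lm (Poly_Mapping.single u c * g) = u + lm g"
proof (rule lead_monom_eqI)
  show "u + lm g \<in> keys (Poly_Mapping.single u c * g)"
    using assms lc_nonzero by (simp add: in_keys_iff lookup_single_mult)
next
  fix b assume "b \<in> keys (Poly_Mapping.single u c * g)"
  then show "le b (u + lm g)"
    using keys_single_mult[of u c g] le_lm[OF assms(1)] le_add_left by auto
qed

definition leads :: "'v rpoly set \<Rightarrow> 'v monom set" where
  "leads G = lm ` (G - {0})"

lemma leads_mono: "G \<subseteq> H \<Longrightarrow> leads G \<subseteq> leads H"
  by (auto simp: leads_def)

text \<open>Multiplying an element of the ideal by a monomial stays in the ideal and shifts the
  leading monomial.\<close>

lemma multiples_leads_ideal_gen: "multiples (leads (ideal_gen G)) = leads (ideal_gen G)"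
proof
  show "multiples (leads (ideal_gen G)) \<subseteq> leads (ideal_gen G)"
  proof
    fix t assume "t \<in> multiples (leads (ideal_gen G))"
    then obtain u p where p: "p \<in> ideal_gen G" "p \<noteq> 0" and t: "t = u + lm p"
      by (auto simp: multiples_def leads_def)
    let ?q = "Poly_Mapping.single u 1 * p"
    have "lookup ?q (u + lm p) \<noteq> 0"
      using lc_nonzero[OF p(2)] by (simp add: lookup_single_mult)
    then have "?q \<noteq> 0" by auto
    moreover have "lm ?q = t" using lm_single_mult[OF p(2)] t by simp
    ultimately show "t \<in> leads (ideal_gen G)"
      using ideal_gen_mult[OF p(1)] unfolding leads_def by blast
  qed
qed (rule subset_multiples)

text \<open>The initial ideal depends on \<open>I\<close> only through \<open>leads I\<close>, so it
  is enough to count the possible sets of leading monomials.\<close>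

lemma init_ideal_leads:
  "init_ideal le I = ideal_gen ((\<lambda>m. Poly_Mapping.single m 1) ` leads I)"
  unfolding init_ideal_def leads_def by (rule arg_cong[of _ _ ideal_gen]) auto

text \<open>Sums of terms \<open>c x^u g\<close> with \<open>g\<close> in \<open>G\<close>, where
  \<open>Q\<close> restricts the leading monomials \<open>u + lm g\<close> of the summands, not only
  that of the sum. For \<open>Q = {s. lt s t}\<close> these are the representations below
  \<open>t\<close> of Buchberger's criterion.\<close>

inductive_set rep :: "'v rpoly set \<Rightarrow> 'v monom set \<Rightarrow> 'v rpoly set" for G Q where
  zero: "0 \<in> rep G Q"
| add: "v \<in> rep G Q \<Longrightarrow> g \<in> G \<Longrightarrow> g \<noteq> 0 \<Longrightarrow> u + lm g \<in> Q \<Longrightarrow>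
    v + Poly_Mapping.single u c * g \<in> rep G Q"

lemma rep_mono:
  assumes "Q \<subseteq> R"
  shows "rep G Q \<subseteq> rep G R"
proof
  fix v assume "v \<in> rep G Q"
  then show "v \<in> rep G R" by induction (use assms in \<open>auto intro: rep.intros\<close>)
qed

lemma rep_add:
  assumes "v \<in> rep G Q" "w \<in> rep G Q"
  shows "v + w \<in> rep G Q"
  using assms(2)
proof induction
  case (add w g u c)
  then show ?case using rep.add[of "v + w" G Q g u c] by (simp add: add.assoc)
qed (use assms(1) in simp)

lemma rep_single_mult:
  assumes "v \<in> rep G Q" "\<And>t. t \<in> Q \<Longrightarrow> w + t \<in> R"
  shows "Poly_Mapping.single w d * v \<in> rep G R"
  using assms(1)
proof induction
  case (add v g u c)
  have "Poly_Mapping.single w d * (v + Poly_Mapping.single u c * g)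
      = Poly_Mapping.single w d * v + Poly_Mapping.single (w + u) (d * c) * g"
    by (simp add: distrib_left mult.assoc[symmetric] mult_single)
  moreover have "w + u + lm g \<in> R" using assms(2)[OF add.hyps(4)] by (simp add: add.assoc)
  ultimately show ?case using rep.add[OF add.IH add.hyps(2,3)] by simp
qed (simp add: rep.zero)

lemma rep_UNIV_mult: "v \<in> rep G UNIV \<Longrightarrow> p * v \<in> rep G UNIV"
proof (induction p rule: Poly_Mapping.update_induct)
  case (update p a b)
  have "Poly_Mapping.update a b p = p + Poly_Mapping.single a b"
    using update.hyps(1)
    by (intro poly_mapping_eqI) (auto simp: lookup_update lookup_add lookup_single in_keys_iff when_def)
  then show ?case
    using update rep_single_mult[of v G UNIV a UNIV b] by (simp add: distrib_right rep_add)
qed (simp add: rep.zero)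

text \<open>Splitting each cofactor into its terms turns an ideal combination into a sum of monomial
  multiples.\<close>

lemma ideal_gen_subset_rep: "ideal_gen G \<subseteq> rep G UNIV"
proof
  fix p assume "p \<in> ideal_gen G"
  then obtain E c where E: "finite E" "E \<subseteq> G" and p: "p = (\<Sum>g\<in>E. c g * g)"
    unfolding ideal_gen_def by blast
  have base: "g \<in> rep G UNIV" if "g \<in> G" for g
    using rep.add[OF rep.zero that, of 0 UNIV 1] rep.zero by (cases "g = 0") auto
  from E have "(\<Sum>g\<in>E. c g * g) \<in> rep G UNIV"
  proof (induction E rule: finite_induct)
    case (insert x F)
    then show ?case by (simp add: rep_add rep_UNIV_mult base)
  qed (simp add: rep.zero)
  then show "p \<in> rep G UNIV" using p by simp
qed

text \<open>A nonempty sum has finitely many summands, so one of their leading monomials is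
  greatest. This turns a strict bound \<open>t\<close> into a weak bound \<open>r\<close> with
  \<open>lt r t\<close>, as needed for induction on the bound.\<close>

lemma rep_bounded:
  assumes "v \<in> rep G Q"
  shows "v = 0 \<or> (\<exists>t\<in>Q. v \<in> rep G {s. le s t})"
  using assms
proof induction
  case (add v g u c)
  let ?s = "u + lm g"
  have one: "Poly_Mapping.single u c * g \<in> rep G {s. le s ?s}"
    using rep.add[OF rep.zero add.hyps(2,3), of u "{s. le s ?s}" c] le_refl by simp
  consider "v = 0" | t where "t \<in> Q" "v \<in> rep G {s. le s t}" using add.IH by blast
  then show ?case
  proof cases
    case 1
    then show ?thesis using one add.hyps(4) by auto
  next
    case 2
    \<comment> \<open>\<open>r\<close> is the greater of the old bound \<open>t\<close> and the
      leading monomial \<open>?s\<close> of the new summand.\<close>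
    obtain r where r: "r \<in> Q" "le t r" "le ?s r"
      using le_total[of t ?s] le_refl 2(1) add.hyps(4) by blast
    have "v \<in> rep G {s. le s r}" "Poly_Mapping.single u c * g \<in> rep G {s. le s r}"
      using 2(2) one rep_mono[of "{s. le s t}" "{s. le s r}" G]
        rep_mono[of "{s. le s ?s}" "{s. le s r}" G] r le_trans by auto
    then show ?thesis using r(1) rep_add by blast
  qed
qed simp

lemma rep_keys:
  assumes "v \<in> rep G {s. lt s t}"
  shows "keys v \<subseteq> {s. lt s t}"
  using assms
proof induction
  case (add v g u c)
  have "lt b t" if "b \<in> keys (Poly_Mapping.single u c * g)" for b
  proof -
    obtain a where a: "a \<in> keys g" "b = u + a"
      using \<open>b \<in> keys _\<close> keys_single_mult by blast
    then have "le b (u + lm g)" using le_lm[OF add.hyps(3)] le_add_left by blast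
    then show ?thesis using add.hyps(4) le_trans le_antisym by blast
  qed
  then show ?case using add.IH keys_add[of v "Poly_Mapping.single u c * g"] by blast
qed simp

text \<open>The shifts \<open>u\<close> and \<open>v\<close> are kept free: the intended use is
  \<open>u + lm g = v + lm h\<close>, where the leading terms cancel. When this common value is the
  lcm, it is the usual S-polynomial.\<close>

definition spol :: "'v rpoly \<Rightarrow> 'v monom \<Rightarrow> 'v rpoly \<Rightarrow> 'v monom \<Rightarrow> 'v rpoly" where
  "spol g u h v = Poly_Mapping.single u (1 / lc g) * g - Poly_Mapping.single v (1 / lc h) * h"

text \<open>Terms with leading monomial exactly \<open>t\<close> differ, up to scalars, by S-polynomials, so they can
  be merged into a single one.\<close>

lemma rep_merge:
  assumes S: "\<And>g h u v. g \<in> G \<Longrightarrow> h \<in> G \<Longrightarrow> g \<noteq> 0 \<Longrightarrow> h \<noteq> 0 \<Longrightarrow> u + lm g = t \<Longrightarrow> v + lm h = t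
      \<Longrightarrow> spol g u h v \<in> rep G {s. lt s t}"
    and f: "f \<in> rep G {s. le s t}"
  shows "f \<in> rep G {s. lt s t} \<or> (\<exists>w\<in>rep G {s. lt s t}. \<exists>g\<in>G. \<exists>u c.
      g \<noteq> 0 \<and> u + lm g = t \<and> f = w + Poly_Mapping.single u c * g)"
  using f
proof induction
  case (add f h v d)
  show ?case
  proof (cases "v + lm h = t")
    case False
    then have "v + lm h \<in> {s. lt s t}" using add.hyps(4) by simp
    note step = rep.add[OF _ add.hyps(2,3) this, of _ d]
    show ?thesis
      using add.IH
    proof
      assume "\<exists>w\<in>rep G {s. lt s t}. \<exists>g\<in>G. \<exists>u c.
        g \<noteq> 0 \<and> u + lm g = t \<and> f = w + Poly_Mapping.single u c * g"
      then obtain w g u c where *: "w \<in> rep G {s. lt s t}" "g \<in> G" "g \<noteq> 0" "u + lm g = t"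
        "f = w + Poly_Mapping.single u c * g" by blast
      have "f + Poly_Mapping.single v d * h
          = (w + Poly_Mapping.single v d * h) + Poly_Mapping.single u c * g"
        using *(5) by (simp add: algebra_simps)
      then show ?thesis using step[OF *(1)] *(2,3,4) by blast
    qed (use step in blast)
  next
    case True
    show ?thesis
      using add.IH
    proof
      assume "f \<in> rep G {s. lt s t}"
      then show ?thesis using add.hyps(2,3) True by blast
    next
      assume "\<exists>w\<in>rep G {s. lt s t}. \<exists>g\<in>G. \<exists>u c.
        g \<noteq> 0 \<and> u + lm g = t \<and> f = w + Poly_Mapping.single u c * g"
      then obtain w g u c where *: "w \<in> rep G {s. lt s t}" "g \<in> G" "g \<noteq> 0" "u + lm g = t"
        "f = w + Poly_Mapping.single u c * g" by blast
      let ?e = "d * lc h"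
      let ?s = "Poly_Mapping.single 0 ?e * spol h v g u"
      have "spol h v g u \<in> rep G {s. lt s t}"
        using S[OF add.hyps(2) *(2) add.hyps(3) *(3) True *(4)] .
      then have "?s \<in> rep G {s. lt s t}"
        by (rule rep_single_mult) simp
      then have w': "w + ?s \<in> rep G {s. lt s t}" using *(1) rep_add by blast
      \<comment> \<open>The factor \<open>?e\<close> makes the part of \<open>?s\<close> coming from
        \<open>h\<close> equal to the new summand. That summand is thus \<open>?s\<close>, which
        lies below \<open>t\<close>, plus a scalar multiple of the summand of \<open>g\<close>
        already present at \<open>t\<close>.\<close>
      have "?s = Poly_Mapping.single v d * h - Poly_Mapping.single u (?e / lc g) * g"
        using lc_nonzero[OF add.hyps(3)]
        by (simp add: spol_def right_diff_distrib mult.assoc[symmetric] mult_single)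
      then have "f + Poly_Mapping.single v d * h
          = (w + ?s) + Poly_Mapping.single u (c + ?e / lc g) * g"
        using *(5) by (simp add: single_add algebra_simps)
      then show ?thesis using w' *(2,3,4) by blast
    qed
  qed
qed (simp add: rep.zero)

text \<open>Induction on the bound \<open>t\<close>. After merging, at most one summand has leading
  monomial \<open>t\<close>. If it has a nonzero coefficient, nothing can cancel it and
  \<open>lm f = t\<close>; otherwise \<open>f\<close> has a representation with a smaller
  bound.\<close>

lemma leads_rep:
  assumes S: "\<And>g h u v. g \<in> G \<Longrightarrow> h \<in> G \<Longrightarrow> g \<noteq> 0 \<Longrightarrow> h \<noteq> 0 \<Longrightarrow> u + lm g = v + lm h
      \<Longrightarrow> spol g u h v \<in> rep G {s. lt s (u + lm g)}"
    and f: "f \<in> rep G {s. le s t}" "f \<noteq> 0"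
  shows "lm f \<in> multiples (leads G)"
  using f
proof (induction t arbitrary: f rule: wf_induct_rule[OF wf_lt])
  case (1 t)
  have smaller: "lm f \<in> multiples (leads G)" if lt: "f \<in> rep G {s. lt s t}"
  proof -
    obtain r where "lt r t" "f \<in> rep G {s. le s r}" using rep_bounded[OF lt] 1(3) by auto
    then show ?thesis using 1(1)[of r f] 1(3) by simp
  qed
  have S': "spol g u h v \<in> rep G {s. lt s t}"
    if "g \<in> G" "h \<in> G" "g \<noteq> 0" "h \<noteq> 0" "u + lm g = t" "v + lm h = t" for g h u v
    using S[OF that(1-4), of u v] that(5,6) by simp
  from rep_merge[OF S' 1(2)] consider "f \<in> rep G {s. lt s t}"
    | w g u c where "w \<in> rep G {s. lt s t}" "g \<in> G" "g \<noteq> 0" "u + lm g = t"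
        "f = w + Poly_Mapping.single u c * g" by blast
  then show ?case
  proof cases
    case 2
    show ?thesis
    proof (cases "c = 0")
      case True
      then show ?thesis using smaller 2 by simp
    next
      case False
      have kw: "keys w \<subseteq> {s. lt s t}" using rep_keys 2(1) by blast
      have "lm f = t"
      proof (rule lead_monom_eqI)
        have "lookup w t = 0" using kw by (auto simp: in_keys_iff)
        then show "t \<in> keys f"
          using 2(4,5) False lc_nonzero[OF 2(3)] lookup_single_mult[of u c g "lm g"]
          by (simp add: in_keys_iff lookup_add)
      next
        fix b assume "b \<in> keys f"
        then consider "b \<in> keys w" | "b \<in> keys (Poly_Mapping.single u c * g)"
          using keys_add[of w "Poly_Mapping.single u c * g"] 2(5) by blast
        then show "le b t"
        proof cases
          case 1 then show ?thesis using kw by auto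
        next
          case c2: 2
          then obtain a where "a \<in> keys g" "b = u + a" using keys_single_mult by blast
          then show ?thesis using le_lm[OF 2(3)] le_add_left 2(4) by blast
        qed
      qed
      then show ?thesis using 2(2-4) multiplesI[of "lm g" "leads G" u] by (auto simp: leads_def)
    qed
  qed (rule smaller)
qed

section \<open>A finite set of exponents closed under reduction\<close>

text \<open>The exponents that can enter when a term at \<open>t\<close> is reduced by a polynomial
  supported in \<open>A\<close>, for every possible leading monomial \<open>m\<close> and whatever
  the coefficients are.\<close>

definition reduct :: "'v monom set \<Rightarrow> 'v monom \<Rightarrow> 'v monom set" where
  "reduct A t = {u + a | u m a. m \<in> A \<and> a \<in> A \<and> t = u + m \<and> lt a m}"

lemma finite_reduct: "finite A \<Longrightarrow> finite (reduct A t)"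
proof (rule finite_subset)
  \<comment> \<open>The shift \<open>u\<close> is recovered from \<open>t\<close> and
    \<open>m\<close> as \<open>t - m\<close>.\<close>
  show "reduct A t \<subseteq> (\<lambda>(m, a). (t - m) + a) ` (A \<times> A)"
    by (force simp: reduct_def)
qed simp

lemma reduct_lt: "s \<in> reduct A t \<Longrightarrow> lt s t"
  unfolding reduct_def using lt_add_left by auto

text \<open>Reduction lowers exponents in a well-founded order and branches finitely, so
  well-founded induction collects everything reachable from \<open>t\<close> in a finite
  set.\<close>

lemma finite_reduct_closed_single:
  assumes A: "finite A"
  shows "\<exists>R. finite R \<and> t \<in> R \<and> (\<forall>s\<in>R. reduct A s \<subseteq> R)"
proof (induction t rule: wf_induct_rule[OF wf_lt])
  case (1 t)
  have "\<exists>R. finite R \<and> s \<in> R \<and> (\<forall>r\<in>R. reduct A r \<subseteq> R)" if "s \<in> reduct A t" for s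
    by (rule 1) (use reduct_lt[OF that] in simp)
  then obtain R where R: "\<And>s. s \<in> reduct A t \<Longrightarrow>
      finite (R s) \<and> s \<in> R s \<and> (\<forall>r\<in>R s. reduct A r \<subseteq> R s)"
    by metis
  show ?case
  proof (intro exI conjI ballI)
    let ?R = "insert t (\<Union>s\<in>reduct A t. R s)"
    show "finite ?R" using R finite_reduct[OF A] by simp
    show "t \<in> ?R" by simp
    show "reduct A s \<subseteq> ?R" if "s \<in> ?R" for s
      using that R by fast
  qed
qed

lemma finite_reduct_closed:
  assumes A: "finite A" and X: "finite X"
  shows "\<exists>R. finite R \<and> X \<subseteq> R \<and> (\<forall>s\<in>R. reduct A s \<subseteq> R)"
proof -
  obtain R where R: "\<And>t. finite (R t) \<and> t \<in> R t \<and> (\<forall>s\<in>R t. reduct A s \<subseteq> R t)"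
    using finite_reduct_closed_single[OF A] by metis
  show ?thesis
    by (rule exI[of _ "\<Union>t\<in>X. R t"]) (use R X in blast)
qed

lemma keys_single_mult_reduct:
  assumes "keys g \<subseteq> A" "g \<noteq> 0" "b \<in> keys (Poly_Mapping.single u c * g)"
  shows "b = u + lm g \<or> b \<in> reduct A (u + lm g)"
proof -
  obtain a where a: "a \<in> keys g" "b = u + a" using assms(3) keys_single_mult by blast
  show ?thesis
  proof (cases "a = lm g")
    case False
    then have "lt a (lm g)" using le_lm[OF assms(2) a(1)] by blast
    moreover have "a \<in> A" "lm g \<in> A" using a(1) lm_in_keys[OF assms(2)] assms(1) by auto
    ultimately show ?thesis using a(2) by (auto simp: reduct_def)
  qed (use a in simp)
qed

lemma keys_cancel_lead:
  assumes g: "keys g \<subseteq> A" "g \<noteq> 0"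
    and c: "lookup p (u + lm g) = c * lc g"
  shows "keys (p - Poly_Mapping.single u c * g) \<subseteq> (keys p - {u + lm g}) \<union> reduct A (u + lm g)"
proof
  fix b assume b: "b \<in> keys (p - Poly_Mapping.single u c * g)"
  then have "b \<noteq> u + lm g"
    using c by (auto simp: in_keys_iff lookup_minus lookup_single_mult)
  then show "b \<in> (keys p - {u + lm g}) \<union> reduct A (u + lm g)"
    using b keys_diff_subset[of p "Poly_Mapping.single u c * g"]
      keys_single_mult_reduct[OF g, of b u c] by blast
qed

text \<open>The division algorithm. By \<open>H\<close>, a nonzero remainder has a leading monomial
  divisible by one of \<open>G\<close>. Cancelling it keeps the remainder in the ideal and its
  support in \<open>R\<close>, so \<open>H\<close> applies again, and the leading monomial drops
  until zero is reached.\<close>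

lemma reduce_to_zero:
  assumes G: "\<And>g. g \<in> G \<Longrightarrow> keys g \<subseteq> A"
    and R: "\<And>s. s \<in> R \<Longrightarrow> reduct A s \<subseteq> R"
    and H: "\<And>p. p \<in> ideal_gen G \<Longrightarrow> p \<noteq> 0 \<Longrightarrow> keys p \<subseteq> R \<Longrightarrow> lm p \<in> multiples (leads G)"
    and p: "p \<in> ideal_gen G" "keys p \<subseteq> R" "keys p \<subseteq> {s. lt s t}"
  shows "p \<in> rep G {s. lt s t}"
  using p
proof (induction t arbitrary: p rule: wf_induct_rule[OF wf_lt])
  case (1 t)
  show ?case
  proof (cases "p = 0")
    case False
    let ?s = "lm p"
    obtain u g where g: "g \<in> G" "g \<noteq> 0" and s: "?s = u + lm g"
      using H[OF 1(2) False 1(3)] by (auto simp: multiples_def leads_def)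
    define c where "c = lc p / lc g"
    let ?q = "p - Poly_Mapping.single u c * g"
    have sR: "?s \<in> R" and st: "lt ?s t" using lm_in_keys[OF False] 1(3,4) by auto
    have "lookup p (u + lm g) = c * lc g"
      using lc_nonzero[OF g(2)] s by (simp add: c_def)
    from keys_cancel_lead[OF G[OF g(1)] g(2) this]
    have q: "keys ?q \<subseteq> (keys p - {?s}) \<union> reduct A ?s" by (simp add: s)
    have "?q \<in> ideal_gen G"
      using 1(2) g(1) ideal_gen_superset[of G] by (intro ideal_gen_diff ideal_gen_mult) auto
    moreover have "keys ?q \<subseteq> R" using q R[OF sR] 1(3) by blast
    moreover have "keys ?q \<subseteq> {r. lt r ?s}" using q reduct_lt le_lm[OF False] by blast
    ultimately have "?q \<in> rep G {r. lt r ?s}" using 1(1)[of ?s ?q] st by simp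
    moreover have "rep G {r. lt r ?s} \<subseteq> rep G {r. lt r t}"
      by (rule rep_mono) (use st lt_trans in blast)
    ultimately have "?q + Poly_Mapping.single u c * g \<in> rep G {s. lt s t}"
      using g s st by (intro rep.add) auto
    then show ?thesis by simp
  qed (simp add: rep.zero)
qed

text \<open>Subtraction of exponents is truncated, so this is the pointwise maximum.\<close>

definition monom_lcm :: "'v monom \<Rightarrow> 'v monom \<Rightarrow> 'v monom" where
  "monom_lcm a b = (b - a) + a"

lemma lookup_monom_lcm: "lookup (monom_lcm a b) v = max (lookup a v) (lookup b v)"
  by (simp add: monom_lcm_def lookup_add minus_poly_mapping.rep_eq)

lemma monom_lcm_left: "(monom_lcm a b - a) + a = monom_lcm a b"
  and monom_lcm_right: "(monom_lcm a b - b) + b = monom_lcm a b"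
  by (rule monom_diff_add, simp add: lookup_monom_lcm)+

text \<open>Every common multiple is a shift of the lcm. Together with \<open>spol_shift\<close>
  this leaves only the finitely many lcms of pairs from \<open>A\<close> to be considered.\<close>

lemma monom_lcm_least:
  assumes "u + a = v + b"
  shows "\<exists>w. u = w + (monom_lcm a b - a) \<and> v = w + (monom_lcm a b - b)"
proof -
  have e: "lookup u x + lookup a x = lookup v x + lookup b x" for x
    using assms by (metis lookup_add)
  \<comment> \<open>The truncated difference is exact, since \<open>u + a\<close> dominates both
    \<open>a\<close> and \<open>b\<close> pointwise.\<close>
  then have "(u + a - monom_lcm a b) + monom_lcm a b = u + a"
    by (intro monom_diff_add) (metis le_add2 lookup_add lookup_monom_lcm max.bounded_iff)
  then have w: "u + a = (u + a - monom_lcm a b) + monom_lcm a b" by simp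
  have "u = (u + a - monom_lcm a b) + (monom_lcm a b - a)"
    using w monom_lcm_left[of a b] by (metis add.assoc add_right_cancel)
  moreover have "v = (u + a - monom_lcm a b) + (monom_lcm a b - b)"
    using w monom_lcm_right[of a b] assms by (metis add.assoc add_right_cancel)
  ultimately show ?thesis by blast
qed

lemma spol_shift:
  "spol g (w + u) h (w + v) = Poly_Mapping.single w 1 * spol g u h v"
  by (simp add: spol_def right_diff_distrib mult.assoc[symmetric] mult_single)

lemma keys_spol:
  assumes g: "keys g \<subseteq> A" "g \<noteq> 0" and h: "keys h \<subseteq> A" "h \<noteq> 0"
    and t: "u + lm g = t" "v + lm h = t"
  shows "keys (spol g u h v) \<subseteq> reduct A t"
proof -
  let ?p = "Poly_Mapping.single u (1 / lc g) * g"
  have "lookup ?p (v + lm h) = 1 / lc h * lc h"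
    using lc_nonzero[OF g(2)] lc_nonzero[OF h(2)] lookup_single_mult[of u "1 / lc g" g "lm g"]
      t by simp
  from keys_cancel_lead[OF h this]
  have "keys (spol g u h v) \<subseteq> (keys ?p - {t}) \<union> reduct A t" by (simp add: spol_def t)
  moreover have "b = t \<or> b \<in> reduct A t" if "b \<in> keys ?p" for b
    using keys_single_mult_reduct[OF g that] t(1) by simp
  ultimately show ?thesis by auto
qed

text \<open>\<open>B\<close> is chosen before \<open>G\<close>: it contains \<open>A\<close> and all
  lcms of pairs from \<open>A\<close>, and is closed under \<open>reduct A\<close>. So the
  S-polynomials at the lcms and all their remainders are supported in \<open>B\<close>, and looking
  at the ideal inside \<open>B\<close> decides Buchberger's criterion.\<close>

lemma finite_buchberger_test:
  assumes A: "finite A"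
  obtains B where "finite B" "A \<subseteq> B"
    "\<And>G. \<forall>g\<in>G. keys g \<subseteq> A \<Longrightarrow>
      leads {p \<in> ideal_gen G. keys p \<subseteq> B} \<subseteq> multiples (leads G) \<Longrightarrow>
      leads (ideal_gen G) = multiples (leads G)"
proof -
  let ?L = "(\<lambda>(a, b). monom_lcm a b) ` (A \<times> A)"
  obtain B where B: "finite B" "A \<union> ?L \<subseteq> B" "\<And>s. s \<in> B \<Longrightarrow> reduct A s \<subseteq> B"
    using finite_reduct_closed[of A "A \<union> ?L"] A by auto
  have "leads (ideal_gen G) = multiples (leads G)"
    if G: "\<And>g. g \<in> G \<Longrightarrow> keys g \<subseteq> A"
      and H: "leads {p \<in> ideal_gen G. keys p \<subseteq> B} \<subseteq> multiples (leads G)" for G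
  proof
    have H': "lm p \<in> multiples (leads G)" if "p \<in> ideal_gen G" "p \<noteq> 0" "keys p \<subseteq> B" for p
      using H that by (auto simp: leads_def)
    have S: "spol g u h v \<in> rep G {s. lt s (u + lm g)}"
      if gh: "g \<in> G" "h \<in> G" "g \<noteq> 0" "h \<noteq> 0" and uv: "u + lm g = v + lm h" for g h u v
    proof -
      let ?l = "monom_lcm (lm g) (lm h)"
      let ?u = "?l - lm g" and ?v = "?l - lm h"
      obtain w where w: "u = w + ?u" "v = w + ?v" using monom_lcm_least[OF uv] by blast
      have "lm g \<in> A" "lm h \<in> A" using gh G lm_in_keys by blast+
      then have "?l \<in> B" using B(2) by auto
      have ks: "keys (spol g ?u h ?v) \<subseteq> reduct A ?l"
        using keys_spol[OF G[OF gh(1)] gh(3) G[OF gh(2)] gh(4)] monom_lcm_left monom_lcm_right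
        by blast
      have "spol g ?u h ?v \<in> ideal_gen G"
        unfolding spol_def using gh(1,2) ideal_gen_superset[of G]
        by (intro ideal_gen_diff ideal_gen_mult) auto
      then have "spol g ?u h ?v \<in> rep G {s. lt s ?l}"
        using ks B(3)[OF \<open>?l \<in> B\<close>] reduct_lt[of _ A ?l]
        by (intro reduce_to_zero[OF G B(3) H']) blast+
      \<comment> \<open>Multiplying by \<open>w\<close> carries the representation at the lcm to the
        given common multiple \<open>u + lm g\<close>.\<close>
      then have "Poly_Mapping.single w 1 * spol g ?u h ?v \<in> rep G {s. lt s (w + ?l)}"
        by (rule rep_single_mult) (use lt_add_left in blast)
      moreover have "w + ?l = u + lm g"
        using w(1) monom_lcm_left[of "lm g" "lm h"] by (simp add: add.assoc)
      ultimately show ?thesis using w spol_shift by metis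
    qed
    show "leads (ideal_gen G) \<subseteq> multiples (leads G)"
    proof
      fix m assume "m \<in> leads (ideal_gen G)"
      then obtain f where f: "f \<in> ideal_gen G" "f \<noteq> 0" "m = lm f" by (auto simp: leads_def)
      then obtain t where "f \<in> rep G {s. le s t}"
        using ideal_gen_subset_rep rep_bounded[of f G UNIV] by blast
      then show "m \<in> multiples (leads G)" using leads_rep[OF S] f by blast
    qed
    show "multiples (leads G) \<subseteq> leads (ideal_gen G)"
      using multiples_mono[OF leads_mono[OF ideal_gen_superset]] multiples_leads_ideal_gen by blast
  qed
  then show ?thesis using that[OF B(1)] B(2) by simp
qed

section \<open>Finiteness\<close>

text \<open>Induction along ascending monomial ideals, with \<open>A\<close> arbitrary because each
  enlargement replaces \<open>A\<close> by \<open>B\<close>. Fixing \<open>leads G = M\<close> gives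
  the induction its parameter.\<close>

lemma finite_leads_ideal_gen_of_leads:
  assumes "finite A"
  shows "finite {leads (ideal_gen G) | G. (\<forall>g\<in>G. keys g \<subseteq> A) \<and> leads G = M}"
  using assms
proof (induction M arbitrary: A rule: wf_induct_rule[OF wf_multiples])
  case (1 M)
  let ?F = "\<lambda>A M. {leads (ideal_gen G) | G. (\<forall>g\<in>G. keys g \<subseteq> A) \<and> leads G = M}"
  obtain B where B: "finite B" "A \<subseteq> B"
    and test: "\<And>G. \<forall>g\<in>G. keys g \<subseteq> A \<Longrightarrow>
      leads {p \<in> ideal_gen G. keys p \<subseteq> B} \<subseteq> multiples (leads G) \<Longrightarrow>
      leads (ideal_gen G) = multiples (leads G)"
    by (rule finite_buchberger_test[OF 1(2)], rule that)
  \<comment> \<open>The possible leading monomial sets after an enlargement that gains something: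
    finitely many subsets of \<open>B\<close>, each covered by the induction hypothesis.\<close>
  let ?N = "{N \<in> Pow B. multiples M \<subset> multiples N}"
  have "?F A M \<subseteq> insert (multiples M) (\<Union>N\<in>?N. ?F B N)"
  proof
    fix L assume "L \<in> ?F A M"
    then obtain G where L: "L = leads (ideal_gen G)" and G: "\<forall>g\<in>G. keys g \<subseteq> A"
      and M: "leads G = M" by blast
    let ?H = "{p \<in> ideal_gen G. keys p \<subseteq> B}"
    have GH: "G \<subseteq> ?H" using G B(2) ideal_gen_superset[of G] by blast
    have eq: "ideal_gen ?H = ideal_gen G"
      using ideal_gen_subset[of ?H G] ideal_gen_subset[of G ?H] GH ideal_gen_superset[of ?H] by blast
    have "leads ?H \<subseteq> B" using lm_in_keys by (auto simp: leads_def)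
    then have HB: "leads ?H \<in> Pow B" by simp
    have LH: "L \<in> ?F B (leads ?H)" unfolding L using eq by (intro CollectI exI[of _ ?H]) simp
    have sub: "multiples M \<subseteq> multiples (leads ?H)"
      unfolding M[symmetric] by (rule multiples_mono[OF leads_mono[OF GH]])
    show "L \<in> insert (multiples M) (\<Union>N\<in>?N. ?F B N)"
    \<comment> \<open>Without a gain the test succeeds and \<open>L\<close> is determined by
      \<open>M\<close>; with a gain, \<open>?H\<close> generates the same ideal and falls under the
      induction hypothesis.\<close>
    proof (cases "multiples (leads ?H) = multiples M")
      case True
      then have "leads ?H \<subseteq> multiples (leads G)" using subset_multiples[of "leads ?H"] M by simp
      then have "L = multiples M" unfolding L using test[of G] G M by simp
      then show ?thesis by simp
    next
      case False
      then have "leads ?H \<in> ?N" using HB sub by blast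
      then show ?thesis using LH by (intro insertI2 UN_I)
    qed
  qed
  moreover have "finite (\<Union>N\<in>?N. ?F B N)"
    using B(1) by (intro finite_UN_I) (auto intro!: 1(1))
  ultimately show ?case by (meson finite_insert finite_subset)
qed

text \<open>The leading monomials of \<open>G\<close> form a subset of \<open>A\<close>, so finitely
  many values of \<open>M\<close> cover all cases.\<close>

lemma finite_init_ideals_of_support:
  assumes A: "finite A"
  shows "finite {init_ideal le (ideal_gen G) | G. \<forall>g\<in>G. keys g \<subseteq> A}"
proof -
  let ?F = "\<lambda>M. {leads (ideal_gen G) | G. (\<forall>g\<in>G. keys g \<subseteq> A) \<and> leads G = M}"
  let ?gen = "\<lambda>M. ideal_gen ((\<lambda>m. Poly_Mapping.single m (1::real)) ` M)"
  have "init_ideal le (ideal_gen G) \<in> ?gen ` (\<Union>M\<in>Pow A. ?F M)"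
    if G: "\<forall>g\<in>G. keys g \<subseteq> A" for G
  proof -
    have "leads G \<in> Pow A" using G lm_in_keys by (auto simp: leads_def)
    moreover have "leads (ideal_gen G) \<in> ?F (leads G)" using G by blast
    ultimately show ?thesis unfolding init_ideal_leads by (intro imageI UN_I)
  qed
  then have "{init_ideal le (ideal_gen G) | G. \<forall>g\<in>G. keys g \<subseteq> A} \<subseteq> ?gen ` (\<Union>M\<in>Pow A. ?F M)"
    by auto
  moreover have "finite (\<Union>M\<in>Pow A. ?F M)"
    using A by (intro finite_UN_I finite_leads_ideal_gen_of_leads) simp_all
  ultimately show ?thesis by (meson finite_imageI finite_subset)
qed

end

section \<open>Supports of the members of an interval family\<close>

lemma keys_family:
  assumes "p \<in> family F"
  shows "keys p \<subseteq> snd ` set F"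
proof
  fix b assume "b \<in> keys p"
  obtain cs where "p = (\<Sum>i<length F. Poly_Mapping.single (snd (F ! i)) (cs ! i))"
    using assms unfolding family_def by auto
  then have "(\<Sum>i<length F. lookup (Poly_Mapping.single (snd (F ! i)) (cs ! i)) b) \<noteq> 0"
    using \<open>b \<in> keys p\<close> by (simp add: in_keys_iff lookup_sum)
  then obtain i where "i < length F" "lookup (Poly_Mapping.single (snd (F ! i)) (cs ! i)) b \<noteq> 0"
    by (auto elim: sum.not_neutral_contains_not_neutral)
  then show "b \<in> snd ` set F"
    by (auto simp: lookup_single when_def split: if_splits)
qed

theorem theorem6p3:
  fixes S :: "('v::finite) interval_poly list"
    and le :: "'v monom \<Rightarrow> 'v monom \<Rightarrow> bool"
  assumes "\<forall>F\<in>set S. \<forall>t\<in>set F. real_interval (fst t)"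
    and "monomial_order le"
  shows "finite {init_ideal le I | I. I \<in> ideal_family S}"
proof -
  interpret mon_order le by unfold_locales (rule assms(2))
  define A where "A = (\<Union>F\<in>set S. snd ` set F)"
  have supp: "\<forall>p\<in>set ps. keys p \<subseteq> A"
    if ps: "length ps = length S" "\<forall>i<length S. ps ! i \<in> family (S ! i)" for ps
  proof
    fix p assume "p \<in> set ps"
    then obtain i where "i < length S" "p = ps ! i" using ps(1) by (metis in_set_conv_nth)
    then show "keys p \<subseteq> A"
      using ps(2) keys_family[of p "S ! i"] nth_mem[of i S] unfolding A_def by blast
  qed
  have "finite A" by (simp add: A_def)
  moreover have "{init_ideal le I | I. I \<in> ideal_family S}
      \<subseteq> {init_ideal le (ideal_gen G) | G. \<forall>g\<in>G. keys g \<subseteq> A}"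
    unfolding ideal_family_def using supp by blast
  ultimately show ?thesis using finite_init_ideals_of_support finite_subset by meson
qed

end
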